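(* Let $n\ge2$, let $\Omega\subset\mathbb{R}^n$ be a bounded convex domain, put $K:=\overline\Omega$, and let $v_0,v_1\in C(\overline\Omega)$ be nonzero convex functions that vanish on $\partial\Omega$. For $0\le t\le1$ define \[ \phi_t:=(1-t)v_0^*+t\,v_1^*,\qquad v_t:=\phi_t^* . \] Then for every $t\in[0,1]$ the function $v_t$ is continuous and convex on $\overline\Omega$, negative in $\Omega$, and zero on $\partial\Omega$. More explicitly, for $x\in\overline\Omega$, \[ v_t(x)=\inf_{\substack{x=(1-t)x_0+t x_1\\ x_0,x_1\in\overline\Omega}}\Bigl((1-t)v_0(x_0)+t\,v_1(x_1)\Bigr). \] Furthermore: (i) whenever $\mathcal E(v_0)<\infty$ and $\mathcal E(v_1)<\infty$, one has $\mathcal E(v_t)=(1-t)\mathcal E(v_0)+t\,\mathcal E(v_1)$ for all $t\in[0,1]$; (ii) for all $s,t\in[0,1]$, $\|v_t-v_s\|_{L^\infty(K)}\le |t-s|\,\|v_1-v_0\|_{L^\infty(K)}$; (iii) if $t=(1-\tau)t_0+\tau t_1$ with $t_0,t_1,\tau\in[0,1]$, then $v_t$ is the weighted infimal convolution of $v_{t_0}$ and $v_{t_1}$ with weights $1-\tau$ and $\tau$, that is, for $x\in\overline\Omega$, \[ v_t(x)=\inf_{\substack{x=(1-\tau)x_0+\tau x_1\\ x_0,x_1\in\overline\Omega}}\Bigl((1-\tau)v_{t_0}(x_0)+\tau\,v_{t_1}(x_1)\Bigr). \]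
   Context: A convex domain is a nonempty open convex set. "Nonzero" means not identically zero. For a convex $v\in C(\overline\Omega)$, extended by $+\infty$ outside $\overline\Omega$, the Legendre transform is $v^*(y):=\sup\{x\cdot y-v(x):x\in\overline\Omega\}$ for $y\in\mathbb{R}^n$; it is finite and convex on $\mathbb{R}^n$. For a finite convex function $\phi$ on $\mathbb{R}^n$, $\phi^*(x):=\sup_{y\in\mathbb{R}^n}(x\cdot y-\phi(y))$. For a convex function $v$ on $\Omega$ and $x\in\Omega$, $\partial v(x)=\{y\in\mathbb{R}^n: v(z)\ge v(x)+y\cdot(z-x)\ \text{for all } z\in\Omega\}$, and $\partial v(E)=\bigcup_{x\in E}\partial v(x)$ for $E\subset\Omega$. The Alexandrov Monge--Ampère measure of $v$ is the Borel measure on $\Omega$ given by $\operatorname{MA}[v](E)=|\partial v(E)|$ (Lebesgue measure). For a convex $v\in C(\overline\Omega)$ vanishing on $\partial\Omega$ (so $v\le 0$), the Monge--Ampère energy is $\mathcal E(v):=\int_\Omega -v\,d\operatorname{MA}[v]\in[0,+\infty]$. *)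

theory Defs
  imports "HOL-Analysis.Analysis" "HOL-Probability.Essential_Supremum"
begin

(* Legendre transform of a function v on K, extended by +infinity outside K: points outside K
   do not contribute to the supremum. It is used for K nonempty compact and v continuous on K,
   so the real supremum is that of a nonempty bounded set. *)
definition legendre_on :: "'a::euclidean_space set \<Rightarrow> ('a \<Rightarrow> real) \<Rightarrow> 'a \<Rightarrow> real" where
  "legendre_on K v y = (SUP x\<in>K. x \<bullet> y - v x)"

(* Extended-real valued: the supremum over the whole space may be +infinity. *)
definition conjugate :: "('a::euclidean_space \<Rightarrow> real) \<Rightarrow> 'a \<Rightarrow> ereal" where
  "conjugate \<phi> x = (SUP y. ereal (x \<bullet> y - \<phi> y))"

definition phi_path ::
  "'a::euclidean_space set \<Rightarrow> ('a \<Rightarrow> real) \<Rightarrow> ('a \<Rightarrow> real) \<Rightarrow> real \<Rightarrow> 'a \<Rightarrow> real" where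
  "phi_path \<Omega> v0 v1 t y =
     (1 - t) * legendre_on (closure \<Omega>) v0 y + t * legendre_on (closure \<Omega>) v1 y"

definition v_path_ereal ::
  "'a::euclidean_space set \<Rightarrow> ('a \<Rightarrow> real) \<Rightarrow> ('a \<Rightarrow> real) \<Rightarrow> real \<Rightarrow> 'a \<Rightarrow> ereal" where
  "v_path_ereal \<Omega> v0 v1 t = conjugate (phi_path \<Omega> v0 v1 t)"

(* Only meaningful where v_path_ereal is finite. *)
definition v_path ::
  "'a::euclidean_space set \<Rightarrow> ('a \<Rightarrow> real) \<Rightarrow> ('a \<Rightarrow> real) \<Rightarrow> real \<Rightarrow> 'a \<Rightarrow> real" where
  "v_path \<Omega> v0 v1 t x = real_of_ereal (v_path_ereal \<Omega> v0 v1 t x)"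

definition subdiff :: "'a::euclidean_space set \<Rightarrow> ('a \<Rightarrow> real) \<Rightarrow> 'a \<Rightarrow> 'a set" where
  "subdiff \<Omega> v x = {y. \<forall>z\<in>\<Omega>. v z \<ge> v x + y \<bullet> (z - x)}"

(* The set function is only countably additive for v convex on the open set \<Omega>; for a set
   function that is not a measure, measure_of would return the zero measure. The completed
   Lebesgue measure is used because subgradient images of Borel sets are Lebesgue measurable. *)
definition MA_measure :: "'a::euclidean_space set \<Rightarrow> ('a \<Rightarrow> real) \<Rightarrow> 'a measure" where
  "MA_measure \<Omega> v = measure_of \<Omega> (sets (restrict_space borel \<Omega>))
     (\<lambda>E. emeasure lebesgue (\<Union>x\<in>E. subdiff \<Omega> v x))"

(* Truncation by ennreal is harmless: v \<le> 0 on \<Omega> where the energy is used. *)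
definition MA_energy :: "'a::euclidean_space set \<Rightarrow> ('a \<Rightarrow> real) \<Rightarrow> ennreal" where
  "MA_energy \<Omega> v = (\<integral>\<^sup>+x. ennreal (- v x) \<partial>MA_measure \<Omega> v)"

definition Linf_norm :: "'a::euclidean_space set \<Rightarrow> ('a \<Rightarrow> real) \<Rightarrow> ereal" where
  "Linf_norm K f = esssup (lebesgue_on K) (\<lambda>x. ereal \<bar>f x\<bar>)"

end

theory Submission
  imports Defs
begin

text \<open>Let K be the closure of the domain. For almost every slope y the maximum of x . y - v(x) over K
  is attained at a unique point g(y): for rationals q < r, the slopes with maximizers on both sides of
  the slab between q and r in a given coordinate meet each line in that coordinate direction at
  most once, by monotonicity of the subdifferential, so they form a null set. Hence the
  Monge-Ampere measure is the image of Lebesgue measure under g, and the energy is the integral of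
  -v(g(y)) over all y, where slopes with g(y) on the boundary contribute 0. Maximizers for v_0 and v_1
  mix to a maximizer for v_t, and so do the values there; thus the integrand, and with it the energy, is
  affine in t. The infimal convolution formula is Fenchel duality, and (iii) is the same formula
  applied to intermediate functions, because the Legendre transform of v_t is phi_t.\<close>

section \<open>Contact sets and the Legendre transform\<close>

text \<open>Maximizers of the supremum in the Legendre transform at slope \<open>y\<close>: the
  points where an affine function of slope \<open>y\<close> touches \<open>v\<close> from below on
  \<open>K\<close>. For \<open>K\<close> nonempty and compact and \<open>v\<close> convex and
  continuous on \<open>K\<close>, this is the subdifferential at \<open>y\<close> of the Legendre
  transform.\<close>

definition contact_set :: "'a::euclidean_space set \<Rightarrow> ('a \<Rightarrow> real) \<Rightarrow> 'a \<Rightarrow> 'a set" where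
  "contact_set K v y = {x \<in> K. \<forall>z\<in>K. z \<bullet> y - v z \<le> x \<bullet> y - v x}"

lemma contact_setD:
  assumes "x \<in> contact_set K v y"
  shows "x \<in> K" and "z \<in> K \<Longrightarrow> z \<bullet> y - v z \<le> x \<bullet> y - v x"
  using assms by (auto simp: contact_set_def)

lemma contact_set_nonempty:
  assumes "compact K" "K \<noteq> {}" "continuous_on K v"
  shows "contact_set K v y \<noteq> {}"
proof -
  have "continuous_on K (\<lambda>x. x \<bullet> y - v x)"
    using assms by (intro continuous_intros)
  then show ?thesis
    using continuous_attains_sup[of K "\<lambda>x. x \<bullet> y - v x"] assms
    by (auto simp: contact_set_def)
qed

lemma legendre_on_eq:
  assumes "x \<in> contact_set K v y"
  shows "legendre_on K v y = x \<bullet> y - v x"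
  unfolding legendre_on_def using assms
  by (intro cSup_eq_maximum) (auto simp: contact_set_def)

lemma legendre_on_upper:
  assumes "compact K" "continuous_on K v" "x \<in> K"
  shows "x \<bullet> y - v x \<le> legendre_on K v y"
proof -
  obtain z where "z \<in> contact_set K v y"
    using contact_set_nonempty[of K v y] assms by auto
  then show ?thesis
    using contact_setD(2)[of z K v y x] legendre_on_eq[of z K v y] assms by simp
qed

lemma legendre_on_least:
  assumes "K \<noteq> {}" "\<And>x. x \<in> K \<Longrightarrow> x \<bullet> y - v x \<le> c"
  shows "legendre_on K v y \<le> c"
  unfolding legendre_on_def using assms by (intro cSUP_least) auto

text \<open>The relation "\<open>x\<close> is a contact point for slope \<open>y\<close>" is closed
  in the product, being an intersection of closed inequalities. Projecting it along the compact
  factor \<open>K\<close> keeps it closed. All Borel measurability in slopes rests on this.\<close>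

lemma closed_contact_set_meets:
  assumes "compact K" "continuous_on K v" "closed C"
  shows "closed {y. contact_set K v y \<inter> C \<noteq> {}}"
proof -
  have "closed {p \<in> K \<times> UNIV. z \<bullet> snd p - v z \<le> fst p \<bullet> snd p - v (fst p)}" for z
    using assms
    by (intro continuous_on_closed_Collect_le continuous_intros
        continuous_on_compose2[OF assms(2)] closed_Times compact_imp_closed) auto
  then have "closed ((\<Inter>z\<in>K. {p \<in> K \<times> UNIV. z \<bullet> snd p - v z \<le> fst p \<bullet> snd p - v (fst p)})
      \<inter> C \<times> UNIV)" (is "closed ?T")
    using assms by (intro closed_Int closed_Inter closed_Times) auto
  then have "closed {y. \<exists>x. x \<in> K \<and> (x, y) \<in> ?T}"
    by (rule closed_compact_projection[OF assms(1)])
  also have "{y. \<exists>x. x \<in> K \<and> (x, y) \<in> ?T} = {y. contact_set K v y \<inter> C \<noteq> {}}"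
    by (auto simp: contact_set_def)
  finally show ?thesis .
qed

section \<open>Almost everywhere uniqueness and measurable choice of contact points\<close>

text \<open>Testing each maximizer against the other and adding the two inequalities cancels
  \<open>v\<close> and leaves monotonicity in direction \<open>b\<close>.\<close>

lemma contact_set_mono:
  assumes "s < s'" "x \<in> contact_set K v (y + s *\<^sub>R b)" "x' \<in> contact_set K v (y + s' *\<^sub>R b)"
  shows "x \<bullet> b \<le> x' \<bullet> b"
proof -
  have "x' \<bullet> (y + s *\<^sub>R b) - v x' \<le> x \<bullet> (y + s *\<^sub>R b) - v x"
    and "x \<bullet> (y + s' *\<^sub>R b) - v x \<le> x' \<bullet> (y + s' *\<^sub>R b) - v x'"
    using assms contact_setD by metis+
  then have "(s' - s) * (x \<bullet> b) \<le> (s' - s) * (x' \<bullet> b)"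
    by (simp add: inner_add_right algebra_simps)
  then show ?thesis using assms(1) by simp
qed

text \<open>Average the measure of the translates of N along b and exchange the integrals.\<close>

lemma null_set_if_lines_meet_once:
  fixes N :: "'a::euclidean_space set" and b :: 'a
  assumes N: "N \<in> sets borel"
    and once: "\<And>y s s'. y + s *\<^sub>R b \<in> N \<Longrightarrow> y + s' *\<^sub>R b \<in> N \<Longrightarrow> s = s'"
  shows "N \<in> null_sets lborel"
proof -
  note [measurable] = N
  have translate: "(\<integral>\<^sup>+y. indicator N (y + s *\<^sub>R b) \<partial>lborel) = emeasure lborel N" for s :: real
  proof -
    have "emeasure lborel N = (\<integral>\<^sup>+y. indicator N y \<partial>distr lborel borel ((+) (s *\<^sub>R b)))"
      unfolding lborel_distr_plus by simp
    also have "\<dots> = (\<integral>\<^sup>+y. indicator N (s *\<^sub>R b + y) \<partial>lborel)"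
      by (subst nn_integral_distr) auto
    finally show ?thesis by (simp add: add.commute)
  qed
  have "emeasure lborel N = (\<integral>\<^sup>+s. emeasure lborel N * indicator {0..1::real} s \<partial>lborel)"
    by (simp add: nn_integral_cmult_indicator)
  also have "\<dots> = (\<integral>\<^sup>+s. (\<integral>\<^sup>+y. indicator N (y + s *\<^sub>R b) * indicator {0..1} s \<partial>lborel) \<partial>lborel)"
    by (subst nn_integral_multc) (auto simp: translate)
  also have "\<dots> = (\<integral>\<^sup>+y. (\<integral>\<^sup>+s. indicator N (y + s *\<^sub>R b) * indicator {0..1} s \<partial>lborel) \<partial>lborel)"
    by (rule lborel_pair.Fubini') measurable
  also have "\<dots> = (\<integral>\<^sup>+y. 0 \<partial>(lborel :: 'a measure))"
  proof (intro nn_integral_cong)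
    \<comment> \<open>The line through \<open>y\<close> in direction \<open>b\<close> meets
      \<open>N\<close> in at most one parameter, and a point is null in the reals.\<close>
    fix y :: 'a
    obtain r where r: "{s. y + s *\<^sub>R b \<in> N} \<subseteq> {r}"
      using once[of y] by blast
    have "(\<integral>\<^sup>+s. indicator N (y + s *\<^sub>R b) * indicator {0..1} s \<partial>lborel)
        \<le> (\<integral>\<^sup>+s. indicator {r} s \<partial>lborel)"
      using r by (intro nn_integral_mono) (auto simp: indicator_def)
    then show "(\<integral>\<^sup>+s. indicator N (y + s *\<^sub>R b) * indicator {0..1} s \<partial>lborel) = 0"
      by simp
  qed
  finally show ?thesis using N by auto
qed

lemma null_set_nonunique_contact:
  fixes K :: "'a::euclidean_space set"
  assumes "compact K" "continuous_on K v" "K \<noteq> {}"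
  shows "{y. \<not> (\<exists>x. contact_set K v y = {x})} \<in> null_sets lborel"
proof -
  \<comment> \<open>Slopes whose contact set reaches both sides of the slab between \<open>q\<close>
    and \<open>r\<close> in direction \<open>b\<close>. Rational thresholds and basis directions
    keep the union countable.\<close>
  define N where "N = (\<lambda>b q r. {y. contact_set K v y \<inter> {x. x \<bullet> b \<le> of_rat q} \<noteq> {}} \<inter>
      {y. contact_set K v y \<inter> {x. of_rat r \<le> x \<bullet> b} \<noteq> {}})"
  have N: "N b q r \<in> null_sets lborel" if "q < r" for b q r
  proof (rule null_set_if_lines_meet_once[where b = b])
    have "closed {x. x \<bullet> b \<le> real_of_rat q}" "closed {x. real_of_rat r \<le> x \<bullet> b}"
      by (auto intro!: closed_Collect_le continuous_intros)
    then show "N b q r \<in> sets borel"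
      unfolding N_def using assms by (intro sets.Int borel_closed closed_contact_set_meets) auto
    fix y s s' assume "y + s *\<^sub>R b \<in> N b q r" "y + s' *\<^sub>R b \<in> N b q r"
    then obtain x1 x2 x1' x2' where
      x: "x1 \<in> contact_set K v (y + s *\<^sub>R b)" "x1 \<bullet> b \<le> of_rat q"
      "x2 \<in> contact_set K v (y + s *\<^sub>R b)" "of_rat r \<le> x2 \<bullet> b" and
      x': "x1' \<in> contact_set K v (y + s' *\<^sub>R b)" "x1' \<bullet> b \<le> of_rat q"
      "x2' \<in> contact_set K v (y + s' *\<^sub>R b)" "of_rat r \<le> x2' \<bullet> b"
      unfolding N_def by blast
    have "real_of_rat q < of_rat r" using that by (simp add: of_rat_less)
    \<comment> \<open>If \<open>s < s'\<close>, monotonicity puts \<open>x2\<close> no further along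
      \<open>b\<close> than \<open>x1'\<close>, which would give \<open>r \<le> q\<close>; the
      opposite order fails in the same way.\<close>
    then show "s = s'"
      using x x' contact_set_mono[of s s' x2 K v y b x1'] contact_set_mono[of s' s x2' K v y b x1]
      by linarith
  qed
  have "{y. \<not> (\<exists>x. contact_set K v y = {x})} = (\<Union>b\<in>Basis. \<Union>q. \<Union>r\<in>{r. q < r}. N b q r)"
  proof (intro equalityI subsetI)
    fix y assume "y \<in> {y. \<not> (\<exists>x. contact_set K v y = {x})}"
    moreover have "contact_set K v y \<noteq> {}" using assms by (simp add: contact_set_nonempty)
    ultimately obtain x x' where x: "x \<in> contact_set K v y" "x' \<in> contact_set K v y" "x \<noteq> x'"
      by blast
    then obtain b where "b \<in> Basis" "x \<bullet> b \<noteq> x' \<bullet> b" by (auto simp: euclidean_eq_iff[of x])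
    with x obtain z z' where z: "z \<in> contact_set K v y" "z' \<in> contact_set K v y" "z \<bullet> b < z' \<bullet> b"
      by (metis linorder_neqE)
    obtain q where q: "z \<bullet> b < of_rat q" "of_rat q < z' \<bullet> b" using of_rat_dense[OF z(3)] by blast
    obtain r where r: "of_rat q < real_of_rat r" "of_rat r < z' \<bullet> b" using of_rat_dense[OF q(2)] by blast
    have "y \<in> N b q r" unfolding N_def using z q r by (auto intro!: less_imp_le)
    moreover have "q < r" using r(1) by (simp add: of_rat_less)
    ultimately show "y \<in> (\<Union>b\<in>Basis. \<Union>q. \<Union>r\<in>{r. q < r}. N b q r)" using \<open>b \<in> Basis\<close> by blast
  next
    fix y assume "y \<in> (\<Union>b\<in>Basis. \<Union>q. \<Union>r\<in>{r. q < r}. N b q r)"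
    then obtain b q r x x' where "q < r" "x \<in> contact_set K v y" "x' \<in> contact_set K v y"
      "x \<bullet> b \<le> of_rat q" "of_rat r \<le> x' \<bullet> b"
      unfolding N_def by blast
    moreover have "real_of_rat q < of_rat r" using \<open>q < r\<close> by (simp add: of_rat_less)
    ultimately show "y \<in> {y. \<not> (\<exists>x. contact_set K v y = {x})}" by force
  qed
  also have "\<dots> \<in> null_sets lborel"
    by (intro null_sets_UN' N) (auto simp: countable_finite)
  finally show ?thesis .
qed

text \<open>Almost everywhere the gradient of the Legendre transform. The junk value lies in K,
  so that v composed with this map is Borel for v continuous on K only.\<close>

definition contact_point :: "'a::euclidean_space set \<Rightarrow> ('a \<Rightarrow> real) \<Rightarrow> 'a \<Rightarrow> 'a" where
  "contact_point K v y =
     (if \<exists>x. contact_set K v y = {x} then the_elem (contact_set K v y) else (SOME x. x \<in> K))"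

lemma AE_contact_set_eq:
  assumes "compact K" "continuous_on K v" "K \<noteq> {}"
  shows "AE y in lborel. contact_set K v y = {contact_point K v y}"
proof -
  have "AE y in lborel. \<exists>x. contact_set K v y = {x}"
    using AE_not_in[OF null_set_nonunique_contact[OF assms]] by simp
  then show ?thesis
  proof eventually_elim
    case (elim y)
    then obtain x where "contact_set K v y = {x}" by blast
    then show ?case by (simp add: contact_point_def)
  qed
qed

text \<open>Closed sets generate the Borel sets. Off the exceptional null set, the preimage of a
  closed \<open>C\<close> is the set of slopes whose contact set meets \<open>C\<close>; on the
  exceptional set, which is Borel, the map is constant.\<close>

lemma borel_measurable_contact_point:
  assumes "compact K" "continuous_on K v" "K \<noteq> {}"
  shows "contact_point K v \<in> borel_measurable borel"
  unfolding borel_eq_closed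
proof (rule measurable_measure_of)
  fix C :: "'a set" assume "C \<in> Collect closed"
  let ?N = "{y. \<not> (\<exists>x. contact_set K v y = {x})}"
  have "contact_point K v -` C =
      ({y. contact_set K v y \<inter> C \<noteq> {}} - ?N) \<union> (?N \<inter> (if (SOME x. x \<in> K) \<in> C then UNIV else {}))"
  proof (intro set_eqI)
    fix y show "y \<in> contact_point K v -` C \<longleftrightarrow>
      y \<in> ({y. contact_set K v y \<inter> C \<noteq> {}} - ?N) \<union> (?N \<inter> (if (SOME x. x \<in> K) \<in> C then UNIV else {}))"
      by (cases "\<exists>x. contact_set K v y = {x}") (auto simp: contact_point_def)
  qed
  moreover have "{y. contact_set K v y \<inter> C \<noteq> {}} \<in> sets borel"
    using \<open>C \<in> Collect closed\<close> assms by (intro borel_closed closed_contact_set_meets) auto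
  moreover have "?N \<in> sets borel"
    using null_setsD2[OF null_set_nonunique_contact[OF assms]] by simp
  ultimately show "contact_point K v -` C \<inter> space (sigma UNIV (Collect closed))
      \<in> sets (sigma UNIV (Collect closed))"
    unfolding borel_eq_closed[symmetric] by auto
qed auto

lemma contact_point_in:
  assumes "K \<noteq> {}"
  shows "contact_point K v y \<in> K"
proof (cases "\<exists>x. contact_set K v y = {x}")
  case True
  then obtain x where "contact_set K v y = {x}" by blast
  then show ?thesis
    using contact_setD(1)[of x K v y] by (simp add: contact_point_def)
next
  case False
  then show ?thesis
    using assms by (simp add: contact_point_def some_in_eq)
qed

lemma borel_measurable_at_contact_point:
  assumes "compact K" "continuous_on K v" "K \<noteq> {}"
  shows "(\<lambda>y. v (contact_point K v y)) \<in> borel_measurable borel"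
proof -
  \<comment> \<open>Outside \<open>K\<close> nothing is known about \<open>v\<close>, so it is
    replaced there by 0; contact points lie in \<open>K\<close> and do not see the change.\<close>
  have "(\<lambda>x. indicator K x *\<^sub>R v x) \<in> borel_measurable borel"
    using assms by (intro borel_measurable_continuous_on_indicator) (auto intro: borel_compact)
  from measurable_compose[OF borel_measurable_contact_point[OF assms] this]
  show ?thesis using contact_point_in[OF assms(3), of v] by simp
qed

section \<open>The Monge-Ampere measure and energy as integrals over slopes\<close>

text \<open>The subgradient inequality is tested on \<open>\<Omega>\<close> only, but passes to the
  closure by continuity.\<close>

lemma subdiff_iff_contact:
  assumes "continuous_on (closure \<Omega>) v" "x \<in> \<Omega>"
  shows "y \<in> subdiff \<Omega> v x \<longleftrightarrow> x \<in> contact_set (closure \<Omega>) v y"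
proof
  assume "y \<in> subdiff \<Omega> v x"
  then have "\<And>z. z \<in> \<Omega> \<Longrightarrow> z \<bullet> y - v z \<le> x \<bullet> y - v x"
    by (auto simp: subdiff_def inner_diff_right inner_commute algebra_simps)
  moreover have "continuous_on (closure \<Omega>) (\<lambda>z. z \<bullet> y - v z)"
    using assms by (intro continuous_intros)
  ultimately have "z \<bullet> y - v z \<le> x \<bullet> y - v x" if "z \<in> closure \<Omega>" for z
    using continuous_le_on_closure[of \<Omega> "\<lambda>z. z \<bullet> y - v z"] that by blast
  then show "x \<in> contact_set (closure \<Omega>) v y"
    using assms closure_subset[of \<Omega>] by (auto simp: contact_set_def)
next
  assume *: "x \<in> contact_set (closure \<Omega>) v y"
  have "z \<bullet> y - v z \<le> x \<bullet> y - v x" if "z \<in> \<Omega>" for z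
    using contact_setD(2)[OF *] that closure_subset[of \<Omega>] by blast
  then show "y \<in> subdiff \<Omega> v x"
    by (fastforce simp: subdiff_def inner_diff_right inner_commute algebra_simps)
qed

text \<open>A slope with a unique contact point lies in the subgradient image of \<open>E\<close>
  exactly when that point lies in \<open>E\<close>. So the set function in \<open>MA_measure\<close>
  agrees with an image measure, which supplies countable additivity.\<close>

lemma MA_measure_eq_distr:
  assumes "open \<Omega>" "bounded \<Omega>" "\<Omega> \<noteq> {}" "continuous_on (closure \<Omega>) v"
  shows "MA_measure \<Omega> v =
    restrict_space (distr lborel borel (contact_point (closure \<Omega>) v)) \<Omega>" (is "_ = ?M")
proof -
  define K where "K = closure \<Omega>"
  let ?g = "contact_point K v"
  have K: "compact K" "continuous_on K v" "K \<noteq> {}"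
    using assms by (auto simp: K_def compact_closure)
  have g [measurable]: "?g \<in> borel_measurable borel"
    using K by (rule borel_measurable_contact_point)
  have sets: "sets ?M = sets (restrict_space borel \<Omega>)" "space ?M = \<Omega>"
    by (auto simp: space_restrict_space sets_restrict_space)
  have eq: "emeasure lebesgue (\<Union>x\<in>E. subdiff \<Omega> v x) = emeasure ?M E"
    if "E \<in> sigma_sets \<Omega> (sets (restrict_space borel \<Omega>))" for E
  proof -
    have "E \<in> sets (restrict_space borel \<Omega>)"
      using that sets.sigma_sets_eq[of "restrict_space borel \<Omega>"] by (simp add: space_restrict_space)
    then have E: "E \<subseteq> \<Omega>" and [measurable]: "E \<in> sets borel"
      using \<open>open \<Omega>\<close> by (auto simp: sets_restrict_space_iff)
    have ae: "AE y in lborel. y \<in> (\<Union>x\<in>E. subdiff \<Omega> v x) \<longleftrightarrow> y \<in> ?g -` E"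
      using AE_contact_set_eq[OF K]
    proof eventually_elim
      case (elim y)
      have "y \<in> (\<Union>x\<in>E. subdiff \<Omega> v x) \<longleftrightarrow> (\<exists>x\<in>E. x \<in> contact_set K v y)"
        using E subdiff_iff_contact[OF assms(4), folded K_def] by (auto simp: subset_eq)
      then show ?case using elim by simp
    qed
    then have ae': "AE y in lebesgue. y \<in> ?g -` E \<longleftrightarrow> y \<in> (\<Union>x\<in>E. subdiff \<Omega> v x)"
      by (auto intro: AE_completion elim: eventually_mono)
    have [measurable]: "?g -` E \<in> sets borel"
      using measurable_sets[OF g \<open>E \<in> sets borel\<close>] by simp
    have "?g -` E \<in> sets lebesgue" by simp
    \<comment> \<open>The subgradient image differs from a Borel set by a null set only, so
      completeness of Lebesgue measure makes it measurable.\<close>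
    with ae' have "(\<Union>x\<in>E. subdiff \<Omega> v x) \<in> sets lebesgue"
      by (rule completion.in_sets_AE) simp
    then have "emeasure lebesgue (\<Union>x\<in>E. subdiff \<Omega> v x) = emeasure lebesgue (?g -` E)"
      using ae' by (intro emeasure_eq_AE) (auto elim: eventually_mono)
    also have "\<dots> = emeasure lborel (?g -` E)" by simp
    also have "\<dots> = emeasure (distr lborel borel ?g) E" by (simp add: emeasure_distr)
    also have "\<dots> = emeasure ?M E"
      using \<open>open \<Omega>\<close> E by (subst emeasure_restrict_space) (auto simp: K_def)
    finally show ?thesis .
  qed
  have "MA_measure \<Omega> v = measure_of \<Omega> (sets (restrict_space borel \<Omega>)) (emeasure ?M)"
    unfolding MA_measure_def by (intro measure_of_eq eq) (auto simp: sets_restrict_space)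
  also have "\<dots> = ?M" using measure_of_of_measure[of ?M] by (simp only: sets)
  finally show ?thesis .
qed

lemma MA_energy_eq:
  assumes "open \<Omega>" "bounded \<Omega>" "\<Omega> \<noteq> {}" "continuous_on (closure \<Omega>) v"
    and zero: "\<And>x. x \<in> frontier \<Omega> \<Longrightarrow> v x = 0"
  shows "MA_energy \<Omega> v = (\<integral>\<^sup>+y. ennreal (- v (contact_point (closure \<Omega>) v y)) \<partial>lborel)"
proof -
  define K where "K = closure \<Omega>"
  let ?g = "contact_point K v"
  have K: "compact K" "continuous_on K v" "K \<noteq> {}"
    using assms by (auto simp: K_def compact_closure)
  have [measurable]: "?g \<in> borel_measurable borel"
    using K by (rule borel_measurable_contact_point)
  \<comment> \<open>The cut-off to \<open>\<Omega>\<close> makes the integrand Borel on the whole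
    space, as the change of variables requires.\<close>
  have "(\<lambda>x. indicator \<Omega> x *\<^sub>R v x) \<in> borel_measurable borel"
    using assms continuous_on_subset[OF assms(4) closure_subset]
    by (intro borel_measurable_continuous_on_indicator) auto
  then have e [measurable]: "(\<lambda>x. ennreal (- (indicator \<Omega> x *\<^sub>R v x))) \<in> borel_measurable borel"
    by measurable
  have "MA_energy \<Omega> v = (\<integral>\<^sup>+x. ennreal (- v x) * indicator \<Omega> x \<partial>distr lborel borel ?g)"
    unfolding MA_energy_def MA_measure_eq_distr[OF assms(1-4)] K_def
    using \<open>open \<Omega>\<close> by (subst nn_integral_restrict_space) auto
  also have "\<dots> = (\<integral>\<^sup>+x. ennreal (- (indicator \<Omega> x *\<^sub>R v x)) \<partial>distr lborel borel ?g)"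
    by (intro nn_integral_cong) (auto simp: indicator_def)
  also have "\<dots> = (\<integral>\<^sup>+y. ennreal (- (indicator \<Omega> (?g y) *\<^sub>R v (?g y))) \<partial>lborel)"
    using e by (intro nn_integral_distr) simp_all
  also have "\<dots> = (\<integral>\<^sup>+y. ennreal (- v (?g y)) \<partial>lborel)"
  proof (rule nn_integral_cong_AE)
    show "AE y in lborel. ennreal (- (indicator \<Omega> (?g y) *\<^sub>R v (?g y))) = ennreal (- v (?g y))"
      using AE_contact_set_eq[OF K]
    proof eventually_elim
      case (elim y)
      \<comment> \<open>The cut-off can now be dropped: a contact point outside
        \<open>\<Omega>\<close> lies on the frontier, where \<open>v\<close> is 0.\<close>
      have "?g y \<in> \<Omega> \<or> ?g y \<in> frontier \<Omega>"
        using elim contact_setD(1)[of "?g y" K v y] closure_Un_frontier[of \<Omega>] by (auto simp: K_def)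
      then show ?case using zero by (auto simp: indicator_def)
    qed
  qed
  finally show ?thesis by (simp add: K_def)
qed

section \<open>Fenchel duality for the interpolation of two convex functions\<close>

text \<open>Boundary values are left out, so that this setting can be entered again with two
  intermediate functions of the path in place of the endpoints.\<close>

locale convex_pair =
  fixes \<Omega> :: "'a::euclidean_space set" and u0 u1 :: "'a \<Rightarrow> real"
  assumes bounded: "bounded \<Omega>" and nonempty: "\<Omega> \<noteq> {}"
    and cont0: "continuous_on (closure \<Omega>) u0" and cont1: "continuous_on (closure \<Omega>) u1"
    and conv0: "convex_on (closure \<Omega>) u0" and conv1: "convex_on (closure \<Omega>) u1"
begin

lemma compact_K: "compact (closure \<Omega>)" and K_nonempty: "closure \<Omega> \<noteq> {}"
  and convex_K: "convex (closure \<Omega>)"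
  using bounded nonempty conv0 by (auto simp: compact_closure convex_on_def)

lemma mix_in_K:
  assumes "t \<in> {0..1}" "x0 \<in> closure \<Omega>" "x1 \<in> closure \<Omega>"
  shows "(1 - t) *\<^sub>R x0 + t *\<^sub>R x1 \<in> closure \<Omega>"
  using convexD_alt[OF convex_K] assms by auto

text \<open>The two Fenchel-Young inequalities, weighted and added. This is the easy half of the
  duality.\<close>

lemma phi_path_ge:
  assumes "t \<in> {0..1}" "x0 \<in> closure \<Omega>" "x1 \<in> closure \<Omega>"
  shows "((1 - t) *\<^sub>R x0 + t *\<^sub>R x1) \<bullet> y - ((1 - t) * u0 x0 + t * u1 x1) \<le> phi_path \<Omega> u0 u1 t y"
proof -
  have "(1 - t) * (x0 \<bullet> y - u0 x0) \<le> (1 - t) * legendre_on (closure \<Omega>) u0 y"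
    "t * (x1 \<bullet> y - u1 x1) \<le> t * legendre_on (closure \<Omega>) u1 y"
    using assms by (auto intro!: mult_left_mono legendre_on_upper compact_K cont0 cont1)
  then show ?thesis by (simp add: phi_path_def inner_add_left algebra_simps)
qed

lemma v_path_ereal_le:
  assumes "t \<in> {0..1}" "x0 \<in> closure \<Omega>" "x1 \<in> closure \<Omega>"
  shows "v_path_ereal \<Omega> u0 u1 t ((1 - t) *\<^sub>R x0 + t *\<^sub>R x1) \<le> ereal ((1 - t) * u0 x0 + t * u1 x1)"
  unfolding v_path_ereal_def conjugate_def
proof (rule SUP_least)
  fix y
  show "ereal (((1 - t) *\<^sub>R x0 + t *\<^sub>R x1) \<bullet> y - phi_path \<Omega> u0 u1 t y)
      \<le> ereal ((1 - t) * u0 x0 + t * u1 x1)"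
    using phi_path_ge[OF assms, of y] by simp
qed

lemma v_path_ereal_ge: "ereal (x \<bullet> y - phi_path \<Omega> u0 u1 t y) \<le> v_path_ereal \<Omega> u0 u1 t x"
  unfolding v_path_ereal_def conjugate_def by (rule SUP_upper) simp

text \<open>Maximizers for \<open>u0\<close> and \<open>u1\<close> at \<open>y\<close> together
  attain \<open>phi_path\<close>, so a bound over all pairs bounds it. With
  \<open>phi_path_ge\<close>, this identifies \<open>phi_path\<close> as the Legendre transform of
  the infimal convolution.\<close>

lemma phi_path_le:
  assumes t: "t \<in> {0..1}"
    and c: "\<And>x0 x1. x0 \<in> closure \<Omega> \<Longrightarrow> x1 \<in> closure \<Omega> \<Longrightarrow>
      ((1 - t) *\<^sub>R x0 + t *\<^sub>R x1) \<bullet> y - ((1 - t) * u0 x0 + t * u1 x1) \<le> c"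
  shows "phi_path \<Omega> u0 u1 t y \<le> c"
proof -
  obtain x0 x1 where x: "x0 \<in> contact_set (closure \<Omega>) u0 y" "x1 \<in> contact_set (closure \<Omega>) u1 y"
    using contact_set_nonempty[OF compact_K K_nonempty cont0, of y]
      contact_set_nonempty[OF compact_K K_nonempty cont1, of y] by auto
  have "phi_path \<Omega> u0 u1 t y =
      ((1 - t) *\<^sub>R x0 + t *\<^sub>R x1) \<bullet> y - ((1 - t) * u0 x0 + t * u1 x1)"
    unfolding phi_path_def legendre_on_eq[OF x(1)] legendre_on_eq[OF x(2)]
    by (simp add: inner_add_left algebra_simps)
  also have "\<dots> \<le> c"
    using x by (intro c) (auto dest: contact_setD)
  finally show ?thesis .
qed

text \<open>Separate (x, c) from the Minkowski combination of the two epigraphs.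
  The separating hyperplane is not vertical because it also separates (x, c) from a point above it.\<close>

lemma affine_minorant:
  assumes t: "t \<in> {0..1}" and x: "x \<in> closure \<Omega>"
    and c: "\<And>x0 x1. x0 \<in> closure \<Omega> \<Longrightarrow> x1 \<in> closure \<Omega> \<Longrightarrow> x = (1 - t) *\<^sub>R x0 + t *\<^sub>R x1 \<Longrightarrow>
      c < (1 - t) * u0 x0 + t * u1 x1"
  shows "\<exists>y. c \<le> x \<bullet> y - phi_path \<Omega> u0 u1 t y"
proof -
  let ?K = "closure \<Omega>"
  define S where "S = {(z, s). \<exists>x0\<in>?K. \<exists>x1\<in>?K. z = (1 - t) *\<^sub>R x0 + t *\<^sub>R x1 \<and>
    (1 - t) * u0 x0 + t * u1 x1 \<le> s}"
  have "convex S"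
    unfolding convex_alt
  proof clarify
    fix a r b s and w :: real
    assume w: "0 \<le> w" "w \<le> 1" and "(a, r) \<in> S" "(b, s) \<in> S"
    then obtain a0 a1 b0 b1 where K: "a0 \<in> ?K" "a1 \<in> ?K" "b0 \<in> ?K" "b1 \<in> ?K"
      and a: "a = (1 - t) *\<^sub>R a0 + t *\<^sub>R a1" "(1 - t) * u0 a0 + t * u1 a1 \<le> r"
      and b: "b = (1 - t) *\<^sub>R b0 + t *\<^sub>R b1" "(1 - t) * u0 b0 + t * u1 b1 \<le> s"
      unfolding S_def by blast
    define p0 p1 where "p0 = (1 - w) *\<^sub>R a0 + w *\<^sub>R b0" and "p1 = (1 - w) *\<^sub>R a1 + w *\<^sub>R b1"
    have "(1 - t) * u0 p0 \<le> (1 - t) * ((1 - w) * u0 a0 + w * u0 b0)"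
      "t * u1 p1 \<le> t * ((1 - w) * u1 a1 + w * u1 b1)"
      unfolding p0_def p1_def using t w K
      by (auto intro!: mult_left_mono convex_onD[OF conv0] convex_onD[OF conv1])
    moreover have "(1 - w) * ((1 - t) * u0 a0 + t * u1 a1) \<le> (1 - w) * r"
      "w * ((1 - t) * u0 b0 + t * u1 b1) \<le> w * s"
      using w a(2) b(2) by (auto intro!: mult_left_mono)
    ultimately have "(1 - t) * u0 p0 + t * u1 p1 \<le> (1 - w) * r + w * s"
      by (simp add: algebra_simps)
    moreover have "(1 - w) *\<^sub>R a + w *\<^sub>R b = (1 - t) *\<^sub>R p0 + t *\<^sub>R p1"
      unfolding a b p0_def p1_def by (simp add: algebra_simps)
    moreover have "p0 \<in> ?K" "p1 \<in> ?K"
      unfolding p0_def p1_def using w K by (auto intro!: mix_in_K)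
    ultimately show "(1 - w) *\<^sub>R (a, r) + w *\<^sub>R (b, s) \<in> S"
      unfolding S_def by auto
  qed
  \<comment> \<open>\<open>S\<close> is the compact set of combined graph points plus the closed
    vertical half-line upwards.\<close>
  moreover have "closed S"
  proof -
    let ?A = "(\<lambda>p. ((1 - t) *\<^sub>R fst p + t *\<^sub>R snd p, (1 - t) * u0 (fst p) + t * u1 (snd p))) ` (?K \<times> ?K)"
    have "compact ?A"
      by (intro compact_continuous_image compact_Times compact_K continuous_intros
          continuous_on_compose2[OF cont0] continuous_on_compose2[OF cont1]) auto
    then have "closed (\<Union>a\<in>?A. \<Union>b\<in>{0} \<times> {0..}. {a + b})"
      by (intro compact_closed_sums closed_Times) auto
    also have "(\<Union>a\<in>?A. \<Union>b\<in>{0} \<times> {0..}. {a + b}) = S" (is "?U = _")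
    proof (intro equalityI subsetI)
      fix p assume "p \<in> S"
      then obtain x0 x1 s where p: "x0 \<in> ?K" "x1 \<in> ?K" "p = ((1 - t) *\<^sub>R x0 + t *\<^sub>R x1, s)"
        "(1 - t) * u0 x0 + t * u1 x1 \<le> s"
        unfolding S_def by blast
      then have "p = ((1 - t) *\<^sub>R x0 + t *\<^sub>R x1, (1 - t) * u0 x0 + t * u1 x1) +
          (0, s - ((1 - t) * u0 x0 + t * u1 x1))"
        by simp
      moreover have "((1 - t) *\<^sub>R x0 + t *\<^sub>R x1, (1 - t) * u0 x0 + t * u1 x1) \<in> ?A"
        using p(1,2) by (intro image_eqI[of _ _ "(x0, x1)"]) auto
      moreover have "(0, s - ((1 - t) * u0 x0 + t * u1 x1)) \<in> {0} \<times> {0..}"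
        using p(4) by simp
      ultimately show "p \<in> ?U" by blast
    next
      fix p assume "p \<in> ?U"
      then show "p \<in> S" by (force simp: S_def)
    qed
    finally show ?thesis .
  qed
  moreover have "(x, c) \<notin> S" using c unfolding S_def by fastforce
  ultimately have "\<exists>q \<beta>. q \<bullet> (x, c) < \<beta> \<and> (\<forall>p\<in>S. \<beta> < q \<bullet> p)"
    by (rule separating_hyperplane_closed_point)
  then obtain q \<beta> where q: "q \<bullet> (x, c) < \<beta>" "\<And>p. p \<in> S \<Longrightarrow> \<beta> < q \<bullet> p"
    by blast
  obtain a \<alpha> where [simp]: "q = (a, \<alpha>)" by (cases q)
  \<comment> \<open>The pair \<open>(x, x)\<close> is an admissible decomposition of
    \<open>x\<close>, so \<open>(x, m)\<close> lies in \<open>S\<close> straight above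
    \<open>(x, c)\<close>; this forces \<open>\<alpha> > 0\<close>.\<close>
  define m where "m = (1 - t) * u0 x + t * u1 x"
  have "c < m" using c[OF x x] by (simp add: m_def algebra_simps)
  moreover have "(x, m) \<in> S"
    unfolding S_def m_def using x by (auto intro!: bexI[of _ x] simp: algebra_simps)
  then have "\<alpha> * c < \<alpha> * m" using q(1) q(2)[of "(x, m)"] by (simp add: inner_Pair)
  ultimately have \<alpha>: "\<alpha> > 0" by (auto simp: mult_less_cancel_left)
  \<comment> \<open>Solved for the last coordinate, the separating hyperplane is the graph of an
    affine function with slope \<open>y\<close> and constant term
    \<open>\<beta> / \<alpha>\<close>.\<close>
  define y where "y = (- 1 / \<alpha>) *\<^sub>R a"
  have y: "z \<bullet> y = - (a \<bullet> z) / \<alpha>" for z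
    by (simp add: y_def inner_commute)
  have below: "z \<bullet> y - s \<le> - \<beta> / \<alpha>" if "(z, s) \<in> S" for z s
    using divide_strict_right_mono[OF q(2)[OF that] \<alpha>] \<alpha> by (simp add: y add_divide_distrib)
  have "phi_path \<Omega> u0 u1 t y \<le> - \<beta> / \<alpha>"
  proof (rule phi_path_le[OF t])
    fix x0 x1 assume "x0 \<in> ?K" "x1 \<in> ?K"
    then have "((1 - t) *\<^sub>R x0 + t *\<^sub>R x1, (1 - t) * u0 x0 + t * u1 x1) \<in> S"
      unfolding S_def by blast
    from below[OF this]
    show "((1 - t) *\<^sub>R x0 + t *\<^sub>R x1) \<bullet> y - ((1 - t) * u0 x0 + t * u1 x1) \<le> - \<beta> / \<alpha>" .
  qed
  moreover have "c \<le> x \<bullet> y + \<beta> / \<alpha>"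
    using divide_strict_right_mono[OF q(1) \<alpha>] \<alpha> by (simp add: y add_divide_distrib)
  ultimately show ?thesis by (intro exI[of _ y]) simp
qed

text \<open>Compactness yields a best decomposition, with value \<open>m\<close>. Were the conjugate
  below \<open>m\<close>, a number \<open>c\<close> strictly between would lie below all
  decompositions, and \<open>affine_minorant\<close> would push the conjugate up to
  \<open>c\<close>. Attainment also shows that the conjugate is finite on the closure.\<close>

lemma v_path_ereal_attained:
  assumes t: "t \<in> {0..1}" and x: "x \<in> closure \<Omega>"
  obtains x0 x1 where "x0 \<in> closure \<Omega>" "x1 \<in> closure \<Omega>" "x = (1 - t) *\<^sub>R x0 + t *\<^sub>R x1"
    "v_path_ereal \<Omega> u0 u1 t x = ereal ((1 - t) * u0 x0 + t * u1 x1)"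
proof -
  let ?K = "closure \<Omega>"
  let ?D = "{p \<in> ?K \<times> ?K. (1 - t) *\<^sub>R fst p + t *\<^sub>R snd p = x}"
  have "?D = (?K \<times> ?K) \<inter> {p. (1 - t) *\<^sub>R fst p + t *\<^sub>R snd p = x}" by auto
  moreover have "closed {p. (1 - t) *\<^sub>R fst p + t *\<^sub>R snd p = x}"
    by (intro closed_Collect_eq continuous_intros)
  ultimately have "compact ?D"
    using compact_Int_closed[OF compact_Times[OF compact_K compact_K]] by simp
  moreover have "(x, x) \<in> ?D" using x by (simp add: algebra_simps)
  then have "?D \<noteq> {}" by blast
  moreover have "continuous_on ?D (\<lambda>p. (1 - t) * u0 (fst p) + t * u1 (snd p))"
    by (intro continuous_intros continuous_on_compose2[OF cont0] continuous_on_compose2[OF cont1]) auto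
  ultimately obtain p where p: "p \<in> ?D" and min: "\<And>p'. p' \<in> ?D \<Longrightarrow>
      (1 - t) * u0 (fst p) + t * u1 (snd p) \<le> (1 - t) * u0 (fst p') + t * u1 (snd p')"
    using continuous_attains_inf[of ?D "\<lambda>p. (1 - t) * u0 (fst p) + t * u1 (snd p)"] by blast
  define m where "m = (1 - t) * u0 (fst p) + t * u1 (snd p)"
  have "ereal m \<le> v_path_ereal \<Omega> u0 u1 t x"
  proof (rule ccontr)
    assume "\<not> ereal m \<le> v_path_ereal \<Omega> u0 u1 t x"
    then obtain c where c: "v_path_ereal \<Omega> u0 u1 t x < ereal c" "ereal c < ereal m"
      using ereal_dense2[of "v_path_ereal \<Omega> u0 u1 t x" "ereal m"] by (auto simp: not_le)
    have "c < (1 - t) * u0 x0 + t * u1 x1"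
      if "x0 \<in> ?K" "x1 \<in> ?K" "x = (1 - t) *\<^sub>R x0 + t *\<^sub>R x1" for x0 x1
      using c(2) min[of "(x0, x1)"] that by (simp add: m_def)
    then obtain y where "c \<le> x \<bullet> y - phi_path \<Omega> u0 u1 t y"
      using affine_minorant[OF t x, of c] by blast
    then have "ereal c \<le> ereal (x \<bullet> y - phi_path \<Omega> u0 u1 t y)" by simp
    also have "\<dots> \<le> v_path_ereal \<Omega> u0 u1 t x" by (rule v_path_ereal_ge)
    finally have "ereal c \<le> v_path_ereal \<Omega> u0 u1 t x" .
    then show False using c(1) by simp
  qed
  moreover have "v_path_ereal \<Omega> u0 u1 t x \<le> ereal m"
    using p v_path_ereal_le[OF t, of "fst p" "snd p"] by (auto simp: m_def)
  ultimately show thesis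
    using p by (intro that[of "fst p" "snd p"]) (auto simp: m_def)
qed

lemma v_path_ereal_eq_INF:
  assumes t: "t \<in> {0..1}" and x: "x \<in> closure \<Omega>"
  shows "v_path_ereal \<Omega> u0 u1 t x =
    (INF (x0, x1)\<in>{(x0, x1). x0 \<in> closure \<Omega> \<and> x1 \<in> closure \<Omega> \<and>
        x = (1 - t) *\<^sub>R x0 + t *\<^sub>R x1}. ereal ((1 - t) * u0 x0 + t * u1 x1))"
proof (rule antisym)
  show "v_path_ereal \<Omega> u0 u1 t x \<le> (INF (x0, x1)\<in>{(x0, x1). x0 \<in> closure \<Omega> \<and> x1 \<in> closure \<Omega> \<and>
        x = (1 - t) *\<^sub>R x0 + t *\<^sub>R x1}. ereal ((1 - t) * u0 x0 + t * u1 x1))"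
    using v_path_ereal_le[OF t] by (intro INF_greatest) auto
  obtain x0 x1 where "x0 \<in> closure \<Omega>" "x1 \<in> closure \<Omega>" "x = (1 - t) *\<^sub>R x0 + t *\<^sub>R x1"
    "v_path_ereal \<Omega> u0 u1 t x = ereal ((1 - t) * u0 x0 + t * u1 x1)"
    by (rule v_path_ereal_attained[OF t x])
  then show "(INF (x0, x1)\<in>{(x0, x1). x0 \<in> closure \<Omega> \<and> x1 \<in> closure \<Omega> \<and>
        x = (1 - t) *\<^sub>R x0 + t *\<^sub>R x1}. ereal ((1 - t) * u0 x0 + t * u1 x1))
      \<le> v_path_ereal \<Omega> u0 u1 t x"
    by (intro INF_lower2[of "(x0, x1)"]) auto
qed

lemma ereal_v_path:
  assumes "t \<in> {0..1}" "x \<in> closure \<Omega>"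
  shows "ereal (v_path \<Omega> u0 u1 t x) = v_path_ereal \<Omega> u0 u1 t x"
proof -
  obtain r where "v_path_ereal \<Omega> u0 u1 t x = ereal r"
    by (rule v_path_ereal_attained[OF assms])
  then show ?thesis by (simp add: v_path_def)
qed

lemma v_path_attained:
  assumes "t \<in> {0..1}" "x \<in> closure \<Omega>"
  obtains x0 x1 where "x0 \<in> closure \<Omega>" "x1 \<in> closure \<Omega>" "x = (1 - t) *\<^sub>R x0 + t *\<^sub>R x1"
    "v_path \<Omega> u0 u1 t x = (1 - t) * u0 x0 + t * u1 x1"
proof (rule v_path_ereal_attained[OF assms])
  fix x0 x1 assume "x0 \<in> closure \<Omega>" "x1 \<in> closure \<Omega>" "x = (1 - t) *\<^sub>R x0 + t *\<^sub>R x1"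
    "v_path_ereal \<Omega> u0 u1 t x = ereal ((1 - t) * u0 x0 + t * u1 x1)"
  then show thesis using ereal_v_path[OF assms] by (intro that[of x0 x1]) auto
qed

lemma v_path_le:
  assumes "t \<in> {0..1}" "x0 \<in> closure \<Omega>" "x1 \<in> closure \<Omega>"
  shows "v_path \<Omega> u0 u1 t ((1 - t) *\<^sub>R x0 + t *\<^sub>R x1) \<le> (1 - t) * u0 x0 + t * u1 x1"
  using v_path_ereal_le[OF assms]
  unfolding ereal_v_path[OF assms(1) mix_in_K[OF assms], symmetric] by simp

lemma v_path_ge:
  assumes "t \<in> {0..1}" "x \<in> closure \<Omega>"
  shows "x \<bullet> y - phi_path \<Omega> u0 u1 t y \<le> v_path \<Omega> u0 u1 t x"
  using v_path_ereal_ge[of x y t] unfolding ereal_v_path[OF assms, symmetric] by simp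

lemma v_path_least:
  assumes "t \<in> {0..1}" "x \<in> closure \<Omega>" "\<And>y. x \<bullet> y - phi_path \<Omega> u0 u1 t y \<le> c"
  shows "v_path \<Omega> u0 u1 t x \<le> c"
proof -
  have "v_path_ereal \<Omega> u0 u1 t x \<le> ereal c"
    unfolding v_path_ereal_def conjugate_def using assms(3) by (intro SUP_least) simp
  then show ?thesis unfolding ereal_v_path[OF assms(1,2), symmetric] by simp
qed

text \<open>At the mixed point, the upper bound from the decomposition equals the lower bound from
  slope \<open>y\<close>, so both are sharp. The affine minorant of slope \<open>y\<close> then
  touches the path there, which makes the point a maximizer and gives the Legendre
  transform.\<close>

lemma contact_set_mix:
  assumes t: "t \<in> {0..1}"
    and x: "x0 \<in> contact_set (closure \<Omega>) u0 y" "x1 \<in> contact_set (closure \<Omega>) u1 y"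
  shows "(1 - t) *\<^sub>R x0 + t *\<^sub>R x1 \<in> contact_set (closure \<Omega>) (v_path \<Omega> u0 u1 t) y" (is "?x \<in> _")
    and "v_path \<Omega> u0 u1 t ((1 - t) *\<^sub>R x0 + t *\<^sub>R x1) = (1 - t) * u0 x0 + t * u1 x1"
    and "legendre_on (closure \<Omega>) (v_path \<Omega> u0 u1 t) y = phi_path \<Omega> u0 u1 t y"
proof -
  note K = x[THEN contact_setD(1)]
  have phi: "phi_path \<Omega> u0 u1 t y = ?x \<bullet> y - ((1 - t) * u0 x0 + t * u1 x1)"
    unfolding phi_path_def legendre_on_eq[OF x(1)] legendre_on_eq[OF x(2)]
    by (simp add: inner_add_left algebra_simps)
  have xK: "?x \<in> closure \<Omega>" using t K by (intro mix_in_K)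
  show eq: "v_path \<Omega> u0 u1 t ?x = (1 - t) * u0 x0 + t * u1 x1"
    using v_path_le[OF t K] v_path_ge[OF t xK, of y] phi by simp
  show c: "?x \<in> contact_set (closure \<Omega>) (v_path \<Omega> u0 u1 t) y"
    using xK v_path_ge[OF t, of _ y] phi eq unfolding contact_set_def by fastforce
  show "legendre_on (closure \<Omega>) (v_path \<Omega> u0 u1 t) y = phi_path \<Omega> u0 u1 t y"
    using legendre_on_eq[OF c] phi eq by simp
qed

lemma legendre_on_v_path:
  assumes "t \<in> {0..1}"
  shows "legendre_on (closure \<Omega>) (v_path \<Omega> u0 u1 t) = phi_path \<Omega> u0 u1 t"
proof
  fix y
  obtain x0 x1 where "x0 \<in> contact_set (closure \<Omega>) u0 y" "x1 \<in> contact_set (closure \<Omega>) u1 y"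
    using contact_set_nonempty[OF compact_K K_nonempty cont0, of y]
      contact_set_nonempty[OF compact_K K_nonempty cont1, of y] by auto
  then show "legendre_on (closure \<Omega>) (v_path \<Omega> u0 u1 t) y = phi_path \<Omega> u0 u1 t y"
    using contact_set_mix(3)[OF assms] by blast
qed

text \<open>A supremum of affine functions: convexity is checked for each slope separately.\<close>

lemma convex_on_v_path:
  assumes t: "t \<in> {0..1}"
  shows "convex_on (closure \<Omega>) (v_path \<Omega> u0 u1 t)"
proof (rule convex_onI[OF _ convex_K])
  fix s :: real and x y assume s: "0 < s" "s < 1" and K: "x \<in> closure \<Omega>" "y \<in> closure \<Omega>"
  show "v_path \<Omega> u0 u1 t ((1 - s) *\<^sub>R x + s *\<^sub>R y)
      \<le> (1 - s) * v_path \<Omega> u0 u1 t x + s * v_path \<Omega> u0 u1 t y"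
  proof (rule v_path_least[OF t])
    fix z
    have "(1 - s) * (x \<bullet> z - phi_path \<Omega> u0 u1 t z) \<le> (1 - s) * v_path \<Omega> u0 u1 t x"
      "s * (y \<bullet> z - phi_path \<Omega> u0 u1 t z) \<le> s * v_path \<Omega> u0 u1 t y"
      using s K t by (auto intro!: mult_left_mono v_path_ge)
    then show "((1 - s) *\<^sub>R x + s *\<^sub>R y) \<bullet> z - phi_path \<Omega> u0 u1 t z
        \<le> (1 - s) * v_path \<Omega> u0 u1 t x + s * v_path \<Omega> u0 u1 t y"
      by (simp add: inner_add_left algebra_simps)
  qed (use s K in \<open>auto intro: mix_in_K\<close>)
qed

text \<open>The Legendre transform is nonexpansive in the uniform norm, \<open>phi_path\<close> is
  affine in its parameter, and the second conjugation is nonexpansive again.\<close>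

lemma abs_v_path_diff_le:
  assumes s: "s \<in> {0..1}" and t: "t \<in> {0..1}"
    and M: "\<And>x. x \<in> closure \<Omega> \<Longrightarrow> \<bar>u1 x - u0 x\<bar> \<le> M" and x: "x \<in> closure \<Omega>"
  shows "\<bar>v_path \<Omega> u0 u1 t x - v_path \<Omega> u0 u1 s x\<bar> \<le> \<bar>t - s\<bar> * M"
proof -
  have leg: "\<bar>legendre_on (closure \<Omega>) u1 y - legendre_on (closure \<Omega>) u0 y\<bar> \<le> M" for y
  proof -
    have "legendre_on (closure \<Omega>) u1 y \<le> legendre_on (closure \<Omega>) u0 y + M"
    proof (rule legendre_on_least[OF K_nonempty])
      fix x assume "x \<in> closure \<Omega>"
      then show "x \<bullet> y - u1 x \<le> legendre_on (closure \<Omega>) u0 y + M"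
        using legendre_on_upper[OF compact_K cont0, of x y] M[of x] by linarith
    qed
    moreover have "legendre_on (closure \<Omega>) u0 y \<le> legendre_on (closure \<Omega>) u1 y + M"
    proof (rule legendre_on_least[OF K_nonempty])
      fix x assume "x \<in> closure \<Omega>"
      then show "x \<bullet> y - u0 x \<le> legendre_on (closure \<Omega>) u1 y + M"
        using legendre_on_upper[OF compact_K cont1, of x y] M[of x] by linarith
    qed
    ultimately show ?thesis by linarith
  qed
  have phi: "\<bar>phi_path \<Omega> u0 u1 r y - phi_path \<Omega> u0 u1 r' y\<bar> \<le> \<bar>r - r'\<bar> * M" for r r' y
  proof -
    have "phi_path \<Omega> u0 u1 r y - phi_path \<Omega> u0 u1 r' y =
        (r - r') * (legendre_on (closure \<Omega>) u1 y - legendre_on (closure \<Omega>) u0 y)"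
      by (simp add: phi_path_def algebra_simps)
    then show ?thesis using leg[of y] by (simp add: abs_mult mult_left_mono)
  qed
  have "v_path \<Omega> u0 u1 r x \<le> v_path \<Omega> u0 u1 r' x + \<bar>t - s\<bar> * M"
    if "r \<in> {0..1}" "r' \<in> {0..1}" "\<bar>r - r'\<bar> = \<bar>t - s\<bar>" for r r'
  proof (rule v_path_least[OF that(1) x])
    fix y show "x \<bullet> y - phi_path \<Omega> u0 u1 r y \<le> v_path \<Omega> u0 u1 r' x + \<bar>t - s\<bar> * M"
      using v_path_ge[OF that(2) x, of y] phi[of r y r', unfolded that(3)] by linarith
  qed
  from this[OF s t] this[OF t s] show ?thesis by (simp add: abs_minus_commute abs_le_iff)
qed

end

section \<open>Signs of convex functions with zero boundary values\<close>

text \<open>A line through an interior point leaves the domain on both sides, so the point is a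
  convex combination of two frontier points, where \<open>v\<close> is 0.\<close>

lemma convex_zero_boundary_nonpos:
  fixes v :: "'a::euclidean_space \<Rightarrow> real"
  assumes "open \<Omega>" "bounded \<Omega>" "convex_on (closure \<Omega>) v"
    and zero: "\<And>x. x \<in> frontier \<Omega> \<Longrightarrow> v x = 0" and x: "x \<in> closure \<Omega>"
  shows "v x \<le> 0"
proof (cases "x \<in> \<Omega>")
  case False
  then show ?thesis using x zero closure_Un_frontier[of \<Omega>] by auto
next
  case True
  then have "x \<in> interior \<Omega>" using \<open>open \<Omega>\<close> by (simp add: interior_open)
  obtain b :: 'a where "b \<in> Basis" using nonempty_Basis by blast
  then have b: "b \<noteq> 0" "- b \<noteq> 0" by auto
  obtain d where d: "0 < d" "x + d *\<^sub>R b \<in> frontier \<Omega>"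
    using ray_to_frontier[OF \<open>bounded \<Omega>\<close> \<open>x \<in> interior \<Omega>\<close> b(1)] by blast
  obtain e where e: "0 < e" "x + e *\<^sub>R (- b) \<in> frontier \<Omega>"
    using ray_to_frontier[OF \<open>bounded \<Omega>\<close> \<open>x \<in> interior \<Omega>\<close> b(2)] by blast
  \<comment> \<open>The weight for which the combination of the two exit points is
    \<open>x\<close>.\<close>
  define u where "u = d / (d + e)"
  have u: "0 \<le> u" "u \<le> 1" and "d = u * (d + e)" using d e by (auto simp: u_def field_simps)
  have "(1 - u) *\<^sub>R (x + d *\<^sub>R b) + u *\<^sub>R (x + e *\<^sub>R (- b)) = x + (d - u * (d + e)) *\<^sub>R b"
    by (simp add: algebra_simps)
  also have "\<dots> = x" using \<open>d = u * (d + e)\<close> by simp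
  finally have "v x \<le> (1 - u) * v (x + d *\<^sub>R b) + u * v (x + e *\<^sub>R (- b))"
    using convex_onD[OF assms(3) u, of "x + d *\<^sub>R b" "x + e *\<^sub>R (- b)"] d e
    by (simp add: frontier_def)
  then show ?thesis using d e zero by simp
qed

text \<open>The ray from a point \<open>p\<close> of negative value through \<open>x\<close> exits
  at a zero of \<open>v\<close>; \<open>x\<close> lies between the two with positive weight on
  \<open>p\<close>.\<close>

lemma convex_zero_boundary_neg:
  fixes v :: "'a::euclidean_space \<Rightarrow> real"
  assumes "open \<Omega>" "bounded \<Omega>" "convex_on (closure \<Omega>) v"
    and zero: "\<And>x. x \<in> frontier \<Omega> \<Longrightarrow> v x = 0"
    and nonzero: "\<exists>x\<in>closure \<Omega>. v x \<noteq> 0" and x: "x \<in> \<Omega>"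
  shows "v x < 0"
proof -
  obtain p where p: "p \<in> closure \<Omega>" "v p \<noteq> 0" using nonzero by blast
  then have neg: "v p < 0" using convex_zero_boundary_nonpos[OF assms(1-4)] by fastforce
  show ?thesis
  proof (cases "x = p")
    case False
    have "x \<in> interior \<Omega>" using x \<open>open \<Omega>\<close> by (simp add: interior_open)
    then obtain d where d: "0 < d" "x + d *\<^sub>R (x - p) \<in> frontier \<Omega>"
      using ray_to_frontier[OF \<open>bounded \<Omega>\<close>, of x "x - p"] False by auto
    define u where "u = d / (1 + d)"
    have u: "0 < u" "u \<le> 1" and "d = u * (1 + d)" using d by (auto simp: u_def field_simps)
    have "(1 - u) *\<^sub>R (x + d *\<^sub>R (x - p)) + u *\<^sub>R p = x + (d - u * (1 + d)) *\<^sub>R (x - p)"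
      by (simp add: algebra_simps)
    also have "\<dots> = x" using \<open>d = u * (1 + d)\<close> by simp
    finally have "v x \<le> (1 - u) * v (x + d *\<^sub>R (x - p)) + u * v p"
      using convex_onD[OF assms(3), of u "x + d *\<^sub>R (x - p)" p] u d p
      by (simp add: frontier_def)
    also have "\<dots> < 0" using d zero u neg by (simp add: mult_pos_neg)
    finally show ?thesis .
  qed (use neg in simp)
qed

section \<open>The essential supremum of continuous functions\<close>

lemma Linf_norm_le:
  assumes "compact K" "continuous_on K f" "\<And>x. x \<in> K \<Longrightarrow> \<bar>f x\<bar> \<le> c"
  shows "Linf_norm K f \<le> ereal c"
  unfolding Linf_norm_def
proof (rule esssup_I)
  have "f \<in> borel_measurable (lebesgue_on K)"
    using assms by (intro continuous_imp_measurable_on_sets_lebesgue)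
      (auto intro: fmeasurableD lmeasurable_compact)
  then show "(\<lambda>x. ereal \<bar>f x\<bar>) \<in> borel_measurable (lebesgue_on K)" by measurable
  show "AE x in lebesgue_on K. ereal \<bar>f x\<bar> \<le> ereal c"
    using assms(3) by (intro AE_I2) simp
qed

text \<open>If the norm were below \<open>r\<close> and \<open>r\<close> below the value at
  \<open>x\<close>, the closed set where the modulus is at most \<open>r\<close> would contain
  almost all of the open \<open>\<Omega>\<close>, hence all of it, hence its closure.\<close>

lemma abs_le_Linf_norm:
  assumes "open \<Omega>" "continuous_on (closure \<Omega>) f" and x: "x \<in> closure \<Omega>"
  shows "ereal \<bar>f x\<bar> \<le> Linf_norm (closure \<Omega>) f"
proof (rule ccontr)
  assume "\<not> ereal \<bar>f x\<bar> \<le> Linf_norm (closure \<Omega>) f"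
  then obtain r where r: "Linf_norm (closure \<Omega>) f < ereal r" "r < \<bar>f x\<bar>"
    using ereal_dense2[of "Linf_norm (closure \<Omega>) f" "ereal \<bar>f x\<bar>"] by (auto simp: not_le)
  let ?C = "{z \<in> closure \<Omega>. \<bar>f z\<bar> \<le> r}"
  have C: "closed ?C"
    using assms by (intro continuous_on_closed_Collect_le continuous_intros) auto
  have "AE z in lebesgue_on (closure \<Omega>). ereal \<bar>f z\<bar> \<le> Linf_norm (closure \<Omega>) f"
    unfolding Linf_norm_def by (rule esssup_AE)
  then have "AE z in lebesgue_on (closure \<Omega>). \<bar>f z\<bar> \<le> r"
    by eventually_elim (use r in \<open>auto dest: le_less_trans\<close>)
  then have "AE z in lebesgue. z \<in> closure \<Omega> \<longrightarrow> \<bar>f z\<bar> \<le> r"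
    by (subst (asm) AE_restrict_space_iff) auto
  then have "AE z\<in>\<Omega> in lebesgue. z \<in> ?C"
    by eventually_elim (use closure_subset[of \<Omega>] in auto)
  then have "\<Omega> \<subseteq> ?C"
    using mem_closed_if_AE_lebesgue_open[OF assms(1) C] by blast
  then have "closure \<Omega> \<subseteq> ?C" using C by (rule closure_minimal)
  then show False using x r by auto
qed

section \<open>The path between functions with zero boundary values\<close>

locale zero_boundary_pair = convex_pair \<Omega> v0 v1 for \<Omega> and v0 v1 :: "'a::euclidean_space \<Rightarrow> real" +
  assumes open_Omega: "open \<Omega>" and convex_Omega: "convex \<Omega>"
    and zero0: "x \<in> frontier \<Omega> \<Longrightarrow> v0 x = 0" and zero1: "x \<in> frontier \<Omega> \<Longrightarrow> v1 x = 0"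
begin

text \<open>In an optimal decomposition of a frontier point, an interior point of positive weight
  would make the combination interior. So every point of positive weight lies on the frontier and
  contributes 0.\<close>

lemma v_path_frontier:
  assumes t: "t \<in> {0..1}" and x: "x \<in> frontier \<Omega>"
  shows "v_path \<Omega> v0 v1 t x = 0"
proof -
  have xK: "x \<in> closure \<Omega>" and xi: "x \<notin> interior \<Omega>" using x by (auto simp: frontier_def)
  obtain x0 x1 where K: "x0 \<in> closure \<Omega>" "x1 \<in> closure \<Omega>"
    and eq: "x = (1 - t) *\<^sub>R x0 + t *\<^sub>R x1" and v: "v_path \<Omega> v0 v1 t x = (1 - t) * v0 x0 + t * v1 x1"
    by (rule v_path_attained[OF t xK])
  have "(1 - t) * v0 x0 = 0"
  proof (cases "t = 1")
    case False
    have "x = x1 - (1 - t) *\<^sub>R (x1 - x0)" unfolding eq by (simp add: algebra_simps)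
    then have "x0 \<notin> interior \<Omega>"
      using mem_interior_closure_convex_shrink[OF convex_Omega _ K(2), of x0 "1 - t"] xi t False by auto
    then show ?thesis using K(1) zero0 by (simp add: frontier_def)
  qed simp
  moreover have "t * v1 x1 = 0"
  proof (cases "t = 0")
    case False
    have "x = x0 - t *\<^sub>R (x0 - x1)" unfolding eq by (simp add: algebra_simps)
    then have "x1 \<notin> interior \<Omega>"
      using mem_interior_closure_convex_shrink[OF convex_Omega _ K(1), of x1 t] xi t False by auto
    then show ?thesis using K(2) zero1 by (simp add: frontier_def)
  qed simp
  ultimately show ?thesis unfolding v by argo
qed

lemma v_path_nonpos:
  assumes "t \<in> {0..1}" "x \<in> closure \<Omega>"
  shows "v_path \<Omega> v0 v1 t x \<le> 0"
  using convex_zero_boundary_nonpos[OF open_Omega bounded convex_on_v_path[OF assms(1)]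
      v_path_frontier[OF assms(1)] assms(2)] .

lemma v_path_neg:
  assumes t: "t \<in> {0..1}" and nonzero: "\<exists>x\<in>closure \<Omega>. v0 x \<noteq> 0" "\<exists>x\<in>closure \<Omega>. v1 x \<noteq> 0"
    and x: "x \<in> \<Omega>"
  shows "v_path \<Omega> v0 v1 t x < 0"
proof -
  have "v0 x < 0" "v1 x < 0"
    using convex_zero_boundary_neg[OF open_Omega bounded conv0 zero0 nonzero(1) x]
      convex_zero_boundary_neg[OF open_Omega bounded conv1 zero1 nonzero(2) x] by auto
  then have "(1 - t) * v0 x + t * v1 x < 0"
    using t convex_bound_lt[of "v0 x" 0 "v1 x" "1 - t" t] by simp
  moreover have "x \<in> closure \<Omega>" using x closure_subset by blast
  then have "v_path \<Omega> v0 v1 t x \<le> (1 - t) * v0 x + t * v1 x"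
    using v_path_le[OF t, of x x] by (simp add: algebra_simps)
  ultimately show ?thesis by simp
qed

text \<open>At a boundary point the path is squeezed between 0 and affine minorants.\<close>

lemma continuous_on_v_path:
  assumes t: "t \<in> {0..1}"
  shows "continuous_on (closure \<Omega>) (v_path \<Omega> v0 v1 t)"
  unfolding continuous_on_def
proof
  fix x assume x: "x \<in> closure \<Omega>"
  let ?v = "v_path \<Omega> v0 v1 t"
  show "(?v \<longlongrightarrow> ?v x) (at x within closure \<Omega>)"
  proof (cases "x \<in> \<Omega>")
    case True
    have "convex_on \<Omega> ?v"
      using convex_on_subset[OF convex_on_v_path[OF t] closure_subset convex_Omega] .
    then have "continuous_on \<Omega> ?v"
      using open_Omega by (intro convex_on_continuous)
    then have "isCont ?v x"
      using open_Omega True by (simp add: continuous_on_eq_continuous_at)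
    then show ?thesis unfolding isCont_def by (rule tendsto_within_subset) simp
  next
    case False
    then have fr: "x \<in> frontier \<Omega>" using x closure_Un_frontier[of \<Omega>] by auto
    then have v0: "?v x = 0" using t by (rule v_path_frontier[rotated])
    show ?thesis
    proof (rule tendstoI)
      fix e :: real assume "0 < e"
      \<comment> \<open>The value 0 at \<open>x\<close> is a supremum over slopes, so some affine
        minorant exceeds \<open>- e\<close> there, and by continuity also nearby.\<close>
      obtain y where y: "- e < x \<bullet> y - phi_path \<Omega> v0 v1 t y"
      proof (rule ccontr)
        assume "\<not> thesis"
        then have "\<And>y. x \<bullet> y - phi_path \<Omega> v0 v1 t y \<le> - e"
          using that by (meson not_le)
        then have "?v x \<le> - e" by (rule v_path_least[OF t x])
        then show False using \<open>?v x = 0\<close> \<open>0 < e\<close> by simp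
      qed
      have "((\<lambda>z. z \<bullet> y - phi_path \<Omega> v0 v1 t y) \<longlongrightarrow> x \<bullet> y - phi_path \<Omega> v0 v1 t y)
          (at x within closure \<Omega>)"
        by (intro tendsto_intros)
      from order_tendstoD(1)[OF this y]
      have "\<forall>\<^sub>F z in at x within closure \<Omega>. - e < z \<bullet> y - phi_path \<Omega> v0 v1 t y" .
      moreover have "\<forall>\<^sub>F z in at x within closure \<Omega>. z \<in> closure \<Omega>"
        by (simp add: eventually_at_filter)
      ultimately show "\<forall>\<^sub>F z in at x within closure \<Omega>. dist (?v z) (?v x) < e"
      proof eventually_elim
        case (elim z)
        then show ?case
          using v_path_ge[OF t elim(2), of y] v_path_nonpos[OF t elim(2)] v0
          by (simp add: dist_real_def)
      qed
    qed
  qed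
qed

text \<open>The integrand -v(g(y)) is linear along the path, since contact points mix linearly.\<close>

lemma MA_energy_v_path:
  assumes t: "t \<in> {0..1}"
  shows "MA_energy \<Omega> (v_path \<Omega> v0 v1 t) =
    ennreal (1 - t) * MA_energy \<Omega> v0 + ennreal t * MA_energy \<Omega> v1"
proof -
  let ?K = "closure \<Omega>" and ?v = "v_path \<Omega> v0 v1 t"
  let ?a = "contact_point ?K v0" and ?b = "contact_point ?K v1" and ?g = "contact_point ?K ?v"
  note K = compact_K K_nonempty
  note contv = continuous_on_v_path[OF t]
  have [measurable]: "(\<lambda>y. v0 (?a y)) \<in> borel_measurable borel"
    "(\<lambda>y. v1 (?b y)) \<in> borel_measurable borel"
    by (rule borel_measurable_at_contact_point[OF K(1) cont0 K(2)],
        rule borel_measurable_at_contact_point[OF K(1) cont1 K(2)])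
  have "AE y in lborel. ennreal (- ?v (?g y)) =
      ennreal (1 - t) * ennreal (- v0 (?a y)) + ennreal t * ennreal (- v1 (?b y))"
    using AE_contact_set_eq[OF K(1) cont0 K(2)] AE_contact_set_eq[OF K(1) cont1 K(2)]
      AE_contact_set_eq[OF K(1) contv K(2)]
  proof eventually_elim
    case (elim y)
    have c: "?a y \<in> contact_set ?K v0 y" "?b y \<in> contact_set ?K v1 y" using elim by auto
    \<comment> \<open>The mixture is a contact point of the path at slope \<open>y\<close>, and that
      contact set is a singleton.\<close>
    have "?g y = (1 - t) *\<^sub>R ?a y + t *\<^sub>R ?b y"
      using contact_set_mix(1)[OF t c] unfolding elim(3) by simp
    then have "?v (?g y) = (1 - t) * v0 (?a y) + t * v1 (?b y)"
      using contact_set_mix(2)[OF t c] by simp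
    then have "- ?v (?g y) = (1 - t) * (- v0 (?a y)) + t * (- v1 (?b y))" by simp
    moreover have "v0 (?a y) \<le> 0" "v1 (?b y) \<le> 0"
      using contact_point_in[OF K(2)] conv0 conv1 zero0 zero1
      by (auto intro!: convex_zero_boundary_nonpos[OF open_Omega bounded])
    moreover have "ennreal ((1 - t) * p + t * q) = ennreal (1 - t) * ennreal p + ennreal t * ennreal q"
      if "0 \<le> p" "0 \<le> q" for p q
      using t that by (simp add: ennreal_plus ennreal_mult)
    ultimately show ?case by (metis neg_0_le_iff_le)
  qed
  then have "MA_energy \<Omega> ?v = (\<integral>\<^sup>+y. ennreal (1 - t) * ennreal (- v0 (?a y)) +
      ennreal t * ennreal (- v1 (?b y)) \<partial>lborel)"
    using MA_energy_eq[OF open_Omega bounded nonempty contv v_path_frontier[OF t]]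
    by (simp cong: nn_integral_cong_AE)
  also have "\<dots> = ennreal (1 - t) * MA_energy \<Omega> v0 + ennreal t * MA_energy \<Omega> v1"
    by (simp add: nn_integral_add nn_integral_cmult zero0 zero1
        MA_energy_eq[OF open_Omega bounded nonempty cont0]
        MA_energy_eq[OF open_Omega bounded nonempty cont1])
  finally show ?thesis .
qed

lemma Linf_norm_v_path_diff_le:
  assumes s: "s \<in> {0..1}" and t: "t \<in> {0..1}"
  shows "Linf_norm (closure \<Omega>) (\<lambda>x. v_path \<Omega> v0 v1 t x - v_path \<Omega> v0 v1 s x)
    \<le> ereal \<bar>t - s\<bar> * Linf_norm (closure \<Omega>) (\<lambda>x. v1 x - v0 x)"
proof -
  let ?N = "Linf_norm (closure \<Omega>) (\<lambda>x. v1 x - v0 x)"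
  have cont: "continuous_on (closure \<Omega>) (\<lambda>x. v1 x - v0 x)"
    using cont0 cont1 by (intro continuous_intros)
  note ge = abs_le_Linf_norm[OF open_Omega cont]
  obtain B where "\<And>x. x \<in> closure \<Omega> \<Longrightarrow> \<bar>v1 x - v0 x\<bar> \<le> B"
    using compact_imp_bounded[OF compact_continuous_image[OF cont compact_K]]
    by (auto simp: bounded_iff)
  then have upper: "?N \<le> ereal B" by (rule Linf_norm_le[OF compact_K cont])
  have "\<exists>z. z \<in> closure \<Omega>" using K_nonempty by auto
  then obtain z where "z \<in> closure \<Omega>" ..
  have "0 \<le> ereal \<bar>v1 z - v0 z\<bar>" by simp
  also have "\<dots> \<le> ?N" using \<open>z \<in> closure \<Omega>\<close> by (rule ge)
  \<comment> \<open>The norm lies between 0 and a real bound, so it is a real number and can serve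
    as the constant in \<open>abs_v_path_diff_le\<close>.\<close>
  finally obtain M where M: "?N = ereal M" using upper by (cases ?N) auto
  have "Linf_norm (closure \<Omega>) (\<lambda>x. v_path \<Omega> v0 v1 t x - v_path \<Omega> v0 v1 s x) \<le> ereal (\<bar>t - s\<bar> * M)"
    using ge M
    by (intro Linf_norm_le compact_K continuous_intros continuous_on_v_path s t
        abs_v_path_diff_le[OF s t]) auto
  then show ?thesis using M by simp
qed

lemma convex_pair_v_path:
  assumes "s \<in> {0..1}" "t \<in> {0..1}"
  shows "convex_pair \<Omega> (v_path \<Omega> v0 v1 s) (v_path \<Omega> v0 v1 t)"
  using assms bounded nonempty by unfold_locales (auto intro: continuous_on_v_path convex_on_v_path)

text \<open>The Legendre transforms of the two intermediate functions are \<open>phi_path\<close> at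
  \<open>t0\<close> and \<open>t1\<close>; since \<open>phi_path\<close> is affine in its parameter,
  mixing them just reparametrizes it.\<close>

lemma v_path_ereal_v_path:
  assumes "t0 \<in> {0..1}" "t1 \<in> {0..1}"
  shows "v_path_ereal \<Omega> (v_path \<Omega> v0 v1 t0) (v_path \<Omega> v0 v1 t1) \<tau> =
    v_path_ereal \<Omega> v0 v1 ((1 - \<tau>) * t0 + \<tau> * t1)"
proof -
  have "phi_path \<Omega> (v_path \<Omega> v0 v1 t0) (v_path \<Omega> v0 v1 t1) \<tau> =
      phi_path \<Omega> v0 v1 ((1 - \<tau>) * t0 + \<tau> * t1)"
    unfolding phi_path_def[of _ "v_path \<Omega> v0 v1 t0"] legendre_on_v_path[OF assms(1)]
      legendre_on_v_path[OF assms(2)]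
    by (auto simp: phi_path_def fun_eq_iff algebra_simps)
  then show ?thesis by (simp add: v_path_ereal_def)
qed

end

theorem lemma2p3:
  fixes \<Omega> :: "(real ^ 'n) set" and v0 v1 :: "real ^ 'n \<Rightarrow> real"
  assumes "CARD('n) \<ge> 2"
    and "open \<Omega>" and "convex \<Omega>" and "\<Omega> \<noteq> {}" and "bounded \<Omega>"
    and "continuous_on (closure \<Omega>) v0" and "convex_on (closure \<Omega>) v0"
    and "\<forall>x\<in>frontier \<Omega>. v0 x = 0" and "\<exists>x\<in>closure \<Omega>. v0 x \<noteq> 0"
    and "continuous_on (closure \<Omega>) v1" and "convex_on (closure \<Omega>) v1"
    and "\<forall>x\<in>frontier \<Omega>. v1 x = 0" and "\<exists>x\<in>closure \<Omega>. v1 x \<noteq> 0"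
  shows "(\<forall>t\<in>{0..1}.
            (\<forall>x\<in>closure \<Omega>. \<bar>v_path_ereal \<Omega> v0 v1 t x\<bar> \<noteq> \<infinity>) \<and>
            continuous_on (closure \<Omega>) (v_path \<Omega> v0 v1 t) \<and>
            convex_on (closure \<Omega>) (v_path \<Omega> v0 v1 t) \<and>
            (\<forall>x\<in>\<Omega>. v_path \<Omega> v0 v1 t x < 0) \<and>
            (\<forall>x\<in>frontier \<Omega>. v_path \<Omega> v0 v1 t x = 0) \<and>
            (\<forall>x\<in>closure \<Omega>. v_path_ereal \<Omega> v0 v1 t x =
               (INF (x0, x1)\<in>{(x0, x1). x0 \<in> closure \<Omega> \<and> x1 \<in> closure \<Omega> \<and>
                                 x = (1 - t) *\<^sub>R x0 + t *\<^sub>R x1}.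
                  ereal ((1 - t) * v0 x0 + t * v1 x1)))) \<and>
         (MA_energy \<Omega> v0 < \<infinity> \<and> MA_energy \<Omega> v1 < \<infinity> \<longrightarrow>
            (\<forall>t\<in>{0..1}. MA_energy \<Omega> (v_path \<Omega> v0 v1 t) =
               ennreal (1 - t) * MA_energy \<Omega> v0 + ennreal t * MA_energy \<Omega> v1)) \<and>
         (\<forall>s\<in>{0..1}. \<forall>t\<in>{0..1}.
            Linf_norm (closure \<Omega>) (\<lambda>x. v_path \<Omega> v0 v1 t x - v_path \<Omega> v0 v1 s x)
              \<le> ereal \<bar>t - s\<bar> * Linf_norm (closure \<Omega>) (\<lambda>x. v1 x - v0 x)) \<and>
         (\<forall>t0\<in>{0..1}. \<forall>t1\<in>{0..1}. \<forall>\<tau>\<in>{0..1}. \<forall>t. t = (1 - \<tau>) * t0 + \<tau> * t1 \<longrightarrow>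
            (\<forall>x\<in>closure \<Omega>. v_path_ereal \<Omega> v0 v1 t x =
               (INF (x0, x1)\<in>{(x0, x1). x0 \<in> closure \<Omega> \<and> x1 \<in> closure \<Omega> \<and>
                                 x = (1 - \<tau>) *\<^sub>R x0 + \<tau> *\<^sub>R x1}.
                  ereal ((1 - \<tau>) * v_path \<Omega> v0 v1 t0 x0 + \<tau> * v_path \<Omega> v0 v1 t1 x1))))"
proof -
  interpret zero_boundary_pair \<Omega> v0 v1
    using assms by unfold_locales auto
  \<comment> \<open>The infimal convolution formula for the intermediate pair, whose conjugate is
    the original path at the mixed parameter.\<close>
  have iii: "v_path_ereal \<Omega> v0 v1 ((1 - \<tau>) * t0 + \<tau> * t1) x =
      (INF (x0, x1)\<in>{(x0, x1). x0 \<in> closure \<Omega> \<and> x1 \<in> closure \<Omega> \<and>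
          x = (1 - \<tau>) *\<^sub>R x0 + \<tau> *\<^sub>R x1}.
        ereal ((1 - \<tau>) * v_path \<Omega> v0 v1 t0 x0 + \<tau> * v_path \<Omega> v0 v1 t1 x1))"
    if "t0 \<in> {0..1}" "t1 \<in> {0..1}" "\<tau> \<in> {0..1}" "x \<in> closure \<Omega>" for t0 t1 \<tau> x
    using convex_pair.v_path_ereal_eq_INF[OF convex_pair_v_path[OF that(1,2)] that(3,4)]
    unfolding v_path_ereal_v_path[OF that(1,2)] .
  have finite: "\<bar>v_path_ereal \<Omega> v0 v1 t x\<bar> \<noteq> \<infinity>" if "t \<in> {0..1}" "x \<in> closure \<Omega>" for t x
    unfolding ereal_v_path[OF that, symmetric] by simp
  show ?thesis
  proof (intro conjI ballI allI impI, goal_cases)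
    case (1 t x)
    then show ?case by (rule finite)
  next
    case (4 t x)
    then show ?case using v_path_neg assms(9,13) by blast
  next
    case (9 t0 t1 \<tau> t x)
    then show ?case using iii by simp
  qed (simp_all only: continuous_on_v_path convex_on_v_path v_path_frontier
      v_path_ereal_eq_INF MA_energy_v_path Linf_norm_v_path_diff_le)
qed

end
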